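(* Let $r\ge 1$ and let $\vec a,\vec b\in(-1,\infty)^r$ satisfy $a_j<b_j$ for $1\le j\le r$. Let $\vec n$ be a multi-index near the diagonal with $|\vec n|\ge 1$, and suppose that $b_j-a_i\notin\mathbb Z_{<0}$ and $b_i-b_j\notin\mathbb Z_{\ge 0}$ whenever $i\ne j$. Let $(A_{\vec n,1},\dots,A_{\vec n,r})$ be the type I polynomials for the weights $(w_1,\dots,w_r)$ on $(0,1)$, normalized so that $F_{\vec n}=\sum_{j=1}^rA_{\vec n,j}w_j$ has Mellin transform $\int_0^1F_{\vec n}(x)x^{s-1}dx=\frac{\Gamma(s+\vec a)}{\Gamma(s+\vec b+\vec n)}(1-s)_{|\vec n|-1}$. Then, for $1\le j\le r$, $$A_{\vec n,j}(x)=\frac{(\vec a-b_j)_1}{(\vec b^{\ast j}-b_j)_1}\sum_{J=1}^r\sum_{K=0}^{n_J-1}P_{\vec n,J}[K]\sum_{k=0}^{K-1+\delta_{j,J}}\frac{(\vec b^{\ast j}-b_J-K)_{k+1}\,(b_j-b_J-K)_k}{(\vec a-b_J-K)_{k+1}}\,x^k,$$ where $$P_{\vec n,J}[K]=\frac{(b_J+K+1)_{|\vec n|-1}}{\prod_{i=1,i\neq J}^r(b_i-b_J-K)_{n_i}}\,\frac{(-1)^K}{K!\,(n_J-K-1)!}.$$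
   Context: Conventions: for a vector $\vec s$, $\Gamma(\vec s)=\prod_j\Gamma(s_j)$ and $(\vec s)_k=\prod_j(s_j)_k$, with $(s)_k=\prod_{i=0}^{k-1}(s+i)$; adding a scalar to a vector means adding it to each component; empty products are $1$ and empty sums are $0$. $\vec b^{\ast j}=(b_1,\dots,b_{j-1},b_{j+1},\dots,b_r)$. $\delta_{j,J}$ is the Kronecker delta, $|\vec n|=n_1+\dots+n_r$, $\vec e_j$ the $j$-th unit vector. A multi-index $\vec n\in\mathbb Z_{\ge0}^r$ is near the diagonal if $|n_i-n_j|\le 1$ for all $i,j$. If $b_j=a_i$ for some $i\ne j$, the zero factor of $(\vec a-b_j)_1$ is understood to be cancelled against the same factor in $(\vec a-b_j-K)_{K+1}$ in the terms with $J=j$, $k=K$. Weights: let $\mathcal B^{a,b}(x)=x^a(1-x)^{b-a-1}/\Gamma(b-a)$ on $(0,1)$ (and $0$ elsewhere), and let $w_0(x;\vec a,\vec b)=\mathcal B^{a_1,b_1}\ast\dots\ast\mathcal B^{a_r,b_r}$ with Mellin convolution $(f\ast g)(x)=\int_0^\infty f(t)g(x/t)\,dt/t$; its Mellin transform is $\Gamma(s+\vec a)/\Gamma(s+\vec b)$. Put $w_j(x)=w_0(x;\vec a,\vec b+\vec e_j)$, with Mellin transform $\Gamma(s+\vec a)/\Gamma(s+\vec b+\vec e_j)$, $1\le j\le r$. Type I polynomials for $\vec n$: real polynomials $A_{\vec n,j}$ with $\deg A_{\vec n,j}\le n_j-1$ ($A_{\vec n,j}=0$ if $n_j=0$), such that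 $F_{\vec n}=\sum_jA_{\vec n,j}w_j$ satisfies $\int_0^1F_{\vec n}(x)x^k\,dx=0$ for $k=0,\dots,|\vec n|-2$. All such $F_{\vec n}$ have Mellin transform equal to a constant times $\frac{\Gamma(s+\vec a)}{\Gamma(s+\vec b+\vec n)}(1-s)_{|\vec n|-1}$, and the normalization takes the constant to be $1$. *)

theory Defs
  imports "HOL-Analysis.Analysis" "HOL-Computational_Algebra.Polynomial"
begin

text \<open>
  A vector in \<open>\<real>\<^sup>r\<close> is a function on \<open>nat\<close>, of which only the values at the indices
  \<open>1, \<dots>, r\<close> matter. Products over components are taken over an explicit index set, so that the
  vector with its \<open>j\<close>-th component removed is the same function over \<open>{1..r} - {j}\<close>.
\<close>

definition vGamma :: "nat set \<Rightarrow> (nat \<Rightarrow> complex) \<Rightarrow> complex" where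
  "vGamma I s = (\<Prod>i\<in>I. Gamma (s i))"

definition vpoch :: "nat set \<Rightarrow> (nat \<Rightarrow> real) \<Rightarrow> nat \<Rightarrow> real" where
  "vpoch I s k = (\<Prod>i\<in>I. pochhammer (s i) k)"

definition msize :: "nat \<Rightarrow> (nat \<Rightarrow> nat) \<Rightarrow> nat" where
  "msize r n = (\<Sum>i=1..r. n i)"

definition near_diagonal :: "nat \<Rightarrow> (nat \<Rightarrow> nat) \<Rightarrow> bool" where
  "near_diagonal r n \<longleftrightarrow> (\<forall>i\<in>{1..r}. \<forall>j\<in>{1..r}. \<bar>int (n i) - int (n j)\<bar> \<le> 1)"

definition beta_weight :: "real \<Rightarrow> real \<Rightarrow> real \<Rightarrow> real" where
  "beta_weight a b x =
     (if 0 < x \<and> x < 1 then x powr a * (1 - x) powr (b - a - 1) / Gamma (b - a) else 0)"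

definition mellin_conv :: "(real \<Rightarrow> real) \<Rightarrow> (real \<Rightarrow> real) \<Rightarrow> real \<Rightarrow> real" where
  "mellin_conv f g x = (LBINT t:{0<..}. f t * g (x / t) / t)"

text \<open>
  The convolution is associated to the left. The value at \<open>r = 0\<close> is a dummy: the unit of Mellin
  convolution is not a function.
\<close>

fun w0 :: "nat \<Rightarrow> (nat \<Rightarrow> real) \<Rightarrow> (nat \<Rightarrow> real) \<Rightarrow> real \<Rightarrow> real" where
  "w0 0 a b = (\<lambda>x. 0)"
| "w0 (Suc 0) a b = beta_weight (a 1) (b 1)"
| "w0 (Suc (Suc m)) a b =
     mellin_conv (w0 (Suc m) a b) (beta_weight (a (Suc (Suc m))) (b (Suc (Suc m))))"

definition weight ::
  "nat \<Rightarrow> (nat \<Rightarrow> real) \<Rightarrow> (nat \<Rightarrow> real) \<Rightarrow> nat \<Rightarrow> real \<Rightarrow> real" where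
  "weight r a b j = w0 r a (\<lambda>i. b i + of_bool (i = j))"

definition mellin_01 :: "(real \<Rightarrow> real) \<Rightarrow> complex \<Rightarrow> complex" where
  "mellin_01 F s =
     (LBINT x:{0<..<1}. complex_of_real (F x) * complex_of_real x powr (s - 1))"

definition linear_form ::
  "nat \<Rightarrow> (nat \<Rightarrow> real \<Rightarrow> real) \<Rightarrow> (nat \<Rightarrow> real poly) \<Rightarrow> real \<Rightarrow> real" where
  "linear_form r w A x = (\<Sum>j=1..r. poly (A j) x * w j x)"

definition type_I ::
  "nat \<Rightarrow> (nat \<Rightarrow> real \<Rightarrow> real) \<Rightarrow> (nat \<Rightarrow> nat) \<Rightarrow> (nat \<Rightarrow> real poly) \<Rightarrow> bool" where
  "type_I r w n A \<longleftrightarrow>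
     (\<forall>j\<in>{1..r}. if n j = 0 then A j = 0 else degree (A j) \<le> n j - 1) \<and>
     (\<forall>k. k + 2 \<le> msize r n \<longrightarrow> (LBINT x:{0<..<1}. linear_form r w A x * x ^ k) = 0)"

text \<open>
  The half-plane \<open>Re s > - min a\<^sub>i\<close> is where the Mellin transforms of the weights converge.
\<close>

definition normalized ::
  "nat \<Rightarrow> (nat \<Rightarrow> real) \<Rightarrow> (nat \<Rightarrow> real) \<Rightarrow> (nat \<Rightarrow> nat) \<Rightarrow> (real \<Rightarrow> real) \<Rightarrow> bool" where
  "normalized r a b n F \<longleftrightarrow>
     (\<forall>s::complex. (\<forall>i\<in>{1..r}. Re s > - a i) \<longrightarrow>
        mellin_01 F s =
          vGamma {1..r} (\<lambda>i. s + of_real (a i)) /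
          vGamma {1..r} (\<lambda>i. s + of_real (b i) + of_nat (n i)) *
          pochhammer (1 - s) (msize r n - 1))"

definition P_coeff :: "nat \<Rightarrow> (nat \<Rightarrow> real) \<Rightarrow> (nat \<Rightarrow> nat) \<Rightarrow> nat \<Rightarrow> nat \<Rightarrow> real" where
  "P_coeff r b n J K =
     pochhammer (b J + real K + 1) (msize r n - 1) /
     (\<Prod>i\<in>{1..r} - {J}. pochhammer (b i - b J - real K) (n i)) *
     ((-1) ^ K / (fact K * fact (n J - K - 1)))"

text \<open>
  The quotient \<open>(a - b\<^sub>j)\<^sub>1 / (a - b\<^sub>J - K)\<^sub>k\<^sub>+\<^sub>1\<close>, formed component by component. In a term with
  \<open>J = j\<close> and \<open>k = K\<close>, the last factor of \<open>(a\<^sub>i - b\<^sub>j - K)\<^sub>K\<^sub>+\<^sub>1\<close> is \<open>a\<^sub>i - b\<^sub>j\<close>; if it vanishes, it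
  is cancelled against the same factor of the numerator, leaving \<open>1 / (a\<^sub>i - b\<^sub>j - K)\<^sub>K\<close>.
\<close>

definition cancelled_quotient ::
  "nat \<Rightarrow> (nat \<Rightarrow> real) \<Rightarrow> (nat \<Rightarrow> real) \<Rightarrow> nat \<Rightarrow> nat \<Rightarrow> nat \<Rightarrow> nat \<Rightarrow> real" where
  "cancelled_quotient r a b j J K k =
     (\<Prod>i=1..r.
        if J = j \<and> k = K \<and> a i = b j
        then 1 / pochhammer (a i - b J - real K) K
        else pochhammer (a i - b j) 1 / pochhammer (a i - b J - real K) (k + 1))"

end

theory Submission
  imports Defs
begin

text \<open>
  The Mellin transform of \<open>x\<^sup>k w\<^sub>j\<close> is \<open>\<Gamma>(s + k + a) / \<Gamma>(s + k + b + e\<^sub>j)\<close>. Dividing by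
  \<open>\<Gamma>(s + a) / \<Gamma>(s + b)\<close>, the normalization says that a linear combination of the rational functions
  \<open>\<phi>\<^sub>j\<^sub>k = (s + a)\<^sub>k / ((s + b)\<^sub>k (s + b\<^sub>j + k))\<close>, whose coefficients are those of the polynomials
  \<open>A\<^sub>j\<close>, equals \<open>(1 - s)\<^sub>N\<^sub>-\<^sub>1 / (s + b)\<^sub>n\<close> with \<open>N = |n|\<close>. The partial fraction expansion of the latter is
  \<open>\<Sum> P\<^sub>J[K] / (s + b\<^sub>J + K)\<close>, each \<open>1 / (s + b\<^sub>J + K)\<close> expands into the \<open>\<phi>\<^sub>j\<^sub>k\<close> by a telescoping sum,
  and the \<open>\<phi>\<^sub>j\<^sub>k\<close> are linearly independent, so coefficients can be compared.
\<close>

subsection \<open>Mellin transforms of the weights\<close>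

text \<open>The nonnegative integral over the whole line is used so that, for nonnegative
  \<open>f\<close>, the equation includes convergence and Tonelli's theorem applies without a prior
  integrability check.\<close>

definition has_mellin :: "(real \<Rightarrow> real) \<Rightarrow> real \<Rightarrow> real \<Rightarrow> bool" where
  "has_mellin f s F \<longleftrightarrow> (\<integral>\<^sup>+x. ennreal (f x * x powr (s - 1)) \<partial>lborel) = ennreal F"

text \<open>This class is closed under Mellin convolution. Vanishing outside (0,1) identifies
  integrals over the line with those over (0,1) and makes the values of \<open>powr\<close> and
  \<open>/\<close> at nonpositive arguments harmless.\<close>

definition weight_like :: "(real \<Rightarrow> real) \<Rightarrow> bool" where
  "weight_like f \<longleftrightarrow> f \<in> borel_measurable borel \<and> (\<forall>x. 0 \<le> f x) \<and> (\<forall>x. x \<notin> {0<..<1} \<longrightarrow> f x = 0)"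

lemma weight_like_measurable: "weight_like f \<Longrightarrow> f \<in> borel_measurable borel"
  by (simp add: weight_like_def)

lemma weight_like_nonneg: "weight_like f \<Longrightarrow> 0 \<le> f x"
  by (simp add: weight_like_def)

lemma weight_like_beta_weight: "a < b \<Longrightarrow> weight_like (beta_weight a b)"
  unfolding weight_like_def
proof (intro conjI)
  show "beta_weight a b \<in> borel_measurable borel"
    unfolding beta_weight_def[abs_def] by measurable
qed (auto simp: beta_weight_def intro!: divide_nonneg_pos Gamma_real_pos)

text \<open>The integral is B(s + a, b - a) = Gamma(s + a) Gamma(b - a) / Gamma(s + b), and the
  factor 1 / Gamma(b - a) in the weight removes Gamma(b - a).\<close>

lemma has_mellin_beta_weight:
  assumes "a < b" "s + a > 0"
  shows "has_mellin (beta_weight a b) s (Gamma (s + a) / Gamma (s + b))"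
proof -
  have "((\<lambda>t. t powr (s + a - 1) * (1 - t) powr (b - a - 1)) has_integral Beta (s + a) (b - a)) {0<..<1}"
    using has_integral_Beta_real[of "s + a" "b - a"] assms by (simp add: has_integral_Icc_iff_Ioo)
  from nn_integral_has_integral_lebesgue'[OF _ this]
  have "(\<integral>\<^sup>+t. ennreal (t powr (s + a - 1) * (1 - t) powr (b - a - 1)) * indicator {0<..<1} t \<partial>lborel)
      = ennreal (Beta (s + a) (b - a))" by simp
  then have "(\<integral>\<^sup>+t. ennreal (1 / Gamma (b - a)) *
      (ennreal (t powr (s + a - 1) * (1 - t) powr (b - a - 1)) * indicator {0<..<1} t) \<partial>lborel)
      = ennreal (1 / Gamma (b - a)) * ennreal (Beta (s + a) (b - a))"
    by (subst nn_integral_cmult) auto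
  also have "\<dots> = ennreal (Gamma (s + a) / Gamma (s + b))"
  proof -
    have "Gamma (b - a) > 0" "Gamma (s + a) > 0" "Gamma (s + b) > 0"
      using assms by (auto intro!: Gamma_real_pos)
    then show ?thesis by (subst ennreal_mult' [symmetric]) (auto simp: Beta_def add.commute)
  qed
  also have "(\<lambda>t. ennreal (1 / Gamma (b - a)) *
      (ennreal (t powr (s + a - 1) * (1 - t) powr (b - a - 1)) * indicator {0<..<1} t))
     = (\<lambda>t. ennreal (beta_weight a b t * t powr (s - 1)))"
  proof
    fix t :: real
    have "Gamma (b - a) > 0" using assms by (auto intro!: Gamma_real_pos)
    then show "ennreal (1 / Gamma (b - a)) *
      (ennreal (t powr (s + a - 1) * (1 - t) powr (b - a - 1)) * indicator {0<..<1} t)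
      = ennreal (beta_weight a b t * t powr (s - 1))"
      by (auto simp: beta_weight_def indicator_def powr_add powr_diff powr_minus ennreal_mult'[symmetric] field_simps)
  qed
  finally show ?thesis by (simp add: has_mellin_def)
qed

text \<open>The integrand is nonnegative, so the two integrals agree, both sides being 0 where the
  integral diverges. Measurability in x then follows without knowing for which x it
  converges.\<close>

lemma mellin_conv_eq_enn2real:
  assumes "weight_like f" "weight_like g"
  shows "mellin_conv f g x = enn2real (\<integral>\<^sup>+t. ennreal (f t * g (x / t) / t) \<partial>lborel)"
proof -
  note [measurable] = weight_like_measurable[OF assms(1)] weight_like_measurable[OF assms(2)]
  have "indicator {0<..} t *\<^sub>R (f t * g (x / t) / t) = f t * g (x / t) / t" for t
    using assms by (cases "t > 0") (auto simp: weight_like_def)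
  then have "mellin_conv f g x = (LBINT t. f t * g (x / t) / t)"
    unfolding mellin_conv_def set_lebesgue_integral_def by presburger
  also have "\<dots> = enn2real (\<integral>\<^sup>+t. ennreal (f t * g (x / t) / t) \<partial>lborel)"
  proof (rule integral_eq_nn_integral)
    have "0 \<le> f t * g (x / t) / t" for t
      using assms by (cases "t > 0") (auto simp: weight_like_def)
    then show "AE t in lborel. 0 \<le> f t * g (x / t) / t" by simp
  qed measurable
  finally show ?thesis .
qed

lemma weight_like_mellin_conv:
  assumes "weight_like f" "weight_like g"
  shows "weight_like (mellin_conv f g)"
  unfolding weight_like_def
proof (intro conjI allI impI)
  note [measurable] = weight_like_measurable[OF assms(1)] weight_like_measurable[OF assms(2)]
  show "mellin_conv f g \<in> borel_measurable borel"
    unfolding mellin_conv_eq_enn2real[OF assms] by measurable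
  show "0 \<le> mellin_conv f g x" for x
    unfolding mellin_conv_eq_enn2real[OF assms] by simp
  show "mellin_conv f g x = 0" if x: "x \<notin> {0<..<1}" for x
  proof -
    have *: "f t * g (x / t) / t = 0" for t
    proof (cases "t \<in> {0<..<1}")
      case True
      then have "x / t \<notin> {0<..<1}" using x by (auto simp: field_simps)
      then show ?thesis using assms by (auto simp: weight_like_def)
    qed (use assms in \<open>auto simp: weight_like_def\<close>)
    show ?thesis unfolding mellin_conv_eq_enn2real[OF assms] * by simp
  qed
qed

text \<open>Tonelli's theorem, then the substitution x = t y in the inner integral, after which the
  integrand splits into f(t) t^(s-1) and g(y) y^(s-1).\<close>

lemma has_mellin_mellin_conv:
  assumes f: "weight_like f" and g: "weight_like g"
    and F: "has_mellin f s F" and G: "has_mellin g s G" and nonneg: "0 \<le> F" "0 \<le> G"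
  shows "has_mellin (mellin_conv f g) s (F * G)"
proof -
  note [measurable] = weight_like_measurable[OF f] weight_like_measurable[OF g]
  define q where "q x = (\<integral>\<^sup>+t. ennreal (f t * g (x / t) / t) \<partial>lborel)" for x
  have [measurable]: "q \<in> borel_measurable borel" unfolding q_def by measurable
  have inner: "(\<integral>\<^sup>+x. ennreal (f t * g (x / t) / t * x powr (s - 1)) \<partial>lborel)
      = ennreal (f t * t powr (s - 1)) * ennreal G" for t
  proof (cases "t > 0")
    case True
    have "(\<integral>\<^sup>+x. ennreal (f t * g (x / t) / t * x powr (s - 1)) \<partial>lborel)
        = ennreal t * (\<integral>\<^sup>+x. ennreal (f t * g (0 + t * x / t) / t * (0 + t * x) powr (s - 1)) \<partial>lborel)"
      using True by (subst nn_integral_real_affine[where t = 0 and c = t]) auto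
    also have "\<dots> = (\<integral>\<^sup>+x. ennreal t * ennreal (f t * g x / t * (t * x) powr (s - 1)) \<partial>lborel)"
      using True by (subst nn_integral_cmult) auto
    also have "\<dots> = (\<integral>\<^sup>+x. ennreal (f t * t powr (s - 1)) * ennreal (g x * x powr (s - 1)) \<partial>lborel)"
    proof (intro nn_integral_cong)
      fix x
      show "ennreal t * ennreal (f t * g x / t * (t * x) powr (s - 1))
          = ennreal (f t * t powr (s - 1)) * ennreal (g x * x powr (s - 1))"
      proof (cases "x > 0")
        case x: True
        with True weight_like_nonneg[OF f, of t] weight_like_nonneg[OF g, of x] show ?thesis
          by (subst (1 2) ennreal_mult'[symmetric]) (auto simp: powr_mult mult_ac)
      next
        case False
        then have "g x = 0" using g by (auto simp: weight_like_def)
        then show ?thesis by simp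
      qed
    qed
    also have "\<dots> = ennreal (f t * t powr (s - 1)) * ennreal G"
      using G by (subst nn_integral_cmult) (auto simp: has_mellin_def)
    finally show ?thesis .
  next
    case False
    then have "f t = 0" using f by (auto simp: weight_like_def)
    then show ?thesis by simp
  qed
  have "(\<integral>\<^sup>+x. q x * ennreal (x powr (s - 1)) \<partial>lborel)
      = (\<integral>\<^sup>+x. (\<integral>\<^sup>+t. ennreal (f t * g (x / t) / t * x powr (s - 1)) \<partial>lborel) \<partial>lborel)"
    unfolding q_def
    by (subst nn_integral_multc[symmetric], measurable)
       (intro nn_integral_cong, simp add: ennreal_mult'' del: times_divide_eq_left)
  also have "\<dots> = (\<integral>\<^sup>+t. (\<integral>\<^sup>+x. ennreal (f t * g (x / t) / t * x powr (s - 1)) \<partial>lborel) \<partial>lborel)"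
    by (rule lborel_pair.Fubini') measurable
  also have "\<dots> = ennreal F * ennreal G"
    unfolding inner using F by (subst nn_integral_multc) (auto simp: has_mellin_def)
  also have "\<dots> = ennreal (F * G)"
    using nonneg by (simp add: ennreal_mult')
  finally have total: "(\<integral>\<^sup>+x. q x * ennreal (x powr (s - 1)) \<partial>lborel) = ennreal (F * G)" .
  \<comment> \<open>\<open>mellin_conv\<close> is 0 where \<open>q\<close> is infinite, so the two
    can be identified only after finiteness of the total integral has ruled this out almost
    everywhere. The point x = 0 is harmless because \<open>0 powr (s - 1)\<close> is 0.\<close>
  then have "AE x in lborel. q x * ennreal (x powr (s - 1)) \<noteq> \<infinity>"
    by (intro nn_integral_PInf_AE) auto
  then have "AE x in lborel. ennreal (mellin_conv f g x * x powr (s - 1)) = q x * ennreal (x powr (s - 1))"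
  proof eventually_elim
    case (elim x)
    show ?case
    proof (cases "x = 0")
      case False
      then have "q x \<noteq> \<infinity>" using elim by (auto simp: ennreal_top_mult)
      then have "ennreal (mellin_conv f g x) = q x"
        unfolding mellin_conv_eq_enn2real[OF f g] q_def[symmetric] by (simp add: less_top[symmetric])
      then show ?thesis by (simp add: ennreal_mult'')
    qed simp
  qed
  then show ?thesis
    unfolding has_mellin_def total[symmetric] by (rule nn_integral_cong_AE)
qed

lemma weight_like_w0:
  assumes "\<And>i. i \<in> {1..r} \<Longrightarrow> a i < b i"
  shows "weight_like (w0 r a b)"
  using assms
proof (induction r a b rule: w0.induct)
  case (1 a b) then show ?case by (simp add: weight_like_def)
next
  case (2 a b) then show ?case by (auto intro!: weight_like_beta_weight)
next
  case (3 m a b)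
  then show ?case
    unfolding w0.simps by (intro weight_like_mellin_conv weight_like_beta_weight) auto
qed

lemma has_mellin_w0:
  assumes "r \<ge> 1" "\<And>i. i \<in> {1..r} \<Longrightarrow> a i < b i" "\<And>i. i \<in> {1..r} \<Longrightarrow> s + a i > 0"
  shows "has_mellin (w0 r a b) s (\<Prod>i=1..r. Gamma (s + a i) / Gamma (s + b i))"
  using assms
proof (induction r a b rule: w0.induct)
  case (1 a b) then show ?case by simp
next
  case (2 a b) then show ?case by (simp add: has_mellin_beta_weight)
next
  case (3 m a b)
  have pos: "0 \<le> Gamma (s + a i) / Gamma (s + b i)" if "i \<in> {1..Suc (Suc m)}" for i
    using "3.prems"(2,3)[OF that] by (intro divide_nonneg_nonneg less_imp_le[OF Gamma_real_pos]) auto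
  have "has_mellin (w0 (Suc (Suc m)) a b) s ((\<Prod>i=1..Suc m. Gamma (s + a i) / Gamma (s + b i)) *
      (Gamma (s + a (Suc (Suc m))) / Gamma (s + b (Suc (Suc m)))))"
    unfolding w0.simps
    by (intro has_mellin_mellin_conv weight_like_beta_weight weight_like_w0 has_mellin_beta_weight
          "3.IH" "3.prems" prod_nonneg pos) auto
  then show ?case by (simp add: prod.atLeast_Suc_atMost_Suc_shift prod.nat_ivl_Suc' mult_ac)
qed

text \<open>The factor x^k only shifts s to s + k. The form \<open>has_bochner_integral\<close>
  carries integrability along, which the finite sums over j and k require.\<close>

lemma weight_moment:
  assumes "r \<ge> 1" "\<And>i. i \<in> {1..r} \<Longrightarrow> a i < b i" "\<And>i. i \<in> {1..r} \<Longrightarrow> s + a i > 0"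
  shows "has_bochner_integral lborel (\<lambda>x. weight r a b j x * x ^ k * x powr (s - 1))
    (\<Prod>i=1..r. Gamma (s + k + a i) / Gamma (s + k + b i + of_bool (i = j)))"
proof -
  define b' where "b' i = b i + of_bool (i = j)" for i
  have b': "a i < b' i" if "i \<in> {1..r}" for i
    using assms(2)[OF that] by (auto simp: b'_def)
  have w: "weight r a b j = w0 r a b'" by (simp add: weight_def b'_def[abs_def])
  have wl: "weight_like (w0 r a b')" using b' by (rule weight_like_w0)
  note [measurable] = weight_like_measurable[OF wl]
  have sk: "s + k + a i > 0" if "i \<in> {1..r}" for i
    using assms(3)[OF that] by simp
  have hm: "has_mellin (w0 r a b') (s + k) (\<Prod>i=1..r. Gamma (s + k + a i) / Gamma (s + k + b' i))"
    using assms(1) b' using sk by (rule has_mellin_w0)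
  have eq: "w0 r a b' x * x ^ k * x powr (s - 1) = w0 r a b' x * x powr (s + k - 1)" for x
  proof (cases "x > 0")
    case True
    then show ?thesis by (simp add: powr_realpow[symmetric] powr_add[symmetric] algebra_simps)
  next
    case False
    then show ?thesis using wl by (auto simp: weight_like_def)
  qed
  have pos: "0 \<le> Gamma (s + k + a i) / Gamma (s + k + b' i)" if "i \<in> {1..r}" for i
    using assms(3)[OF that] b'[OF that]
    by (intro divide_nonneg_nonneg less_imp_le[OF Gamma_real_pos]) auto
  have "has_bochner_integral lborel (\<lambda>x. w0 r a b' x * x powr (s + k - 1))
      (\<Prod>i=1..r. Gamma (s + k + a i) / Gamma (s + k + b' i))"
    using hm pos
    by (intro has_bochner_integral_nn_integral prod_nonneg) 
       (auto simp: has_mellin_def intro!: mult_nonneg_nonneg weight_like_nonneg[OF wl])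
  then show ?thesis unfolding w eq by (simp add: b'_def add_ac)
qed

text \<open>Linearity reduces this to the moments. Real s suffice because the transforms are
  compared only on the ray s > 1, and for real s the complex power on (0,1) is a real one.\<close>

lemma mellin_01_linear_form:
  fixes A :: "nat \<Rightarrow> real poly"
  assumes "r \<ge> 1" "\<And>i. i \<in> {1..r} \<Longrightarrow> a i < b i" "\<And>i. i \<in> {1..r} \<Longrightarrow> s + a i > 0"
  shows "mellin_01 (linear_form r (weight r a b) A) (of_real s) =
    of_real (\<Sum>j=1..r. \<Sum>k\<le>degree (A j). coeff (A j) k *
      (\<Prod>i=1..r. Gamma (s + k + a i) / Gamma (s + k + b i + of_bool (i = j))))" (is "_ = of_real ?R")
proof -
  define g where "g x = (\<Sum>j=1..r. \<Sum>k\<le>degree (A j). coeff (A j) k *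
      (weight r a b j x * x ^ k * x powr (s - 1)))" for x
  have g: "has_bochner_integral lborel g ?R"
    unfolding g_def[abs_def]
    by (intro has_bochner_integral_sum has_bochner_integral_mult_right weight_moment assms)
  have lf: "linear_form r (weight r a b) A x * x powr (s - 1) = g x" for x
    unfolding g_def linear_form_def
    by (simp add: poly_altdef sum_distrib_left sum_distrib_right mult_ac)
  have supp: "g x = 0" if "x \<notin> {0<..<1}" for x
  proof -
    have "weight r a b j x = 0" for j
      using weight_like_w0[of r a "\<lambda>i. b i + of_bool (i = j)"] assms(2) that
      by (force simp: weight_like_def weight_def)
    then show ?thesis by (simp add: g_def)
  qed
  have "indicator {0<..<1} x *\<^sub>R (complex_of_real (linear_form r (weight r a b) A x) *
      complex_of_real x powr (of_real s - 1)) = complex_of_real (g x)" for x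
  proof (cases "x \<in> {0<..<1}")
    case True
    then have "complex_of_real x powr (of_real s - 1) = complex_of_real (x powr (s - 1))"
      by (subst powr_of_real[symmetric]) auto
    then show ?thesis using True by (simp flip: lf)
  qed (simp add: supp)
  then have "mellin_01 (linear_form r (weight r a b) A) (of_real s) = (LBINT x. complex_of_real (g x))"
    unfolding mellin_01_def set_lebesgue_integral_def by presburger
  also have "\<dots> = of_real (LBINT x. g x)" by simp
  also have "(LBINT x. g x) = ?R" using g by (rule has_bochner_integral_integral_eq)
  finally show ?thesis .
qed

subsection \<open>Partial fractions\<close>

text \<open>As the degree of \<open>p\<close> is below the number of nodes, \<open>p\<close> equals
  its Lagrange interpolant \<open>q\<close> on \<open>S\<close>; dividing by the product over
  \<open>S\<close> gives the expansion.\<close>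

lemma partial_fractions:
  fixes p :: "real poly" and S :: "real set"
  assumes fin: "finite S" and deg: "degree p < card S" and y: "y \<notin> S"
  shows "poly p y / (\<Prod>z\<in>S. y - z) = (\<Sum>z\<in>S. poly p z / (\<Prod>w\<in>S - {z}. z - w) / (y - z))"
proof -
  define L where "L z = (\<Prod>w\<in>S - {z}. [:- w, 1:])" for z :: real
  define q where "q = (\<Sum>z\<in>S. smult (poly p z / (\<Prod>w\<in>S - {z}. z - w)) (L z))"
  have L: "poly (L z) x = (\<Prod>w\<in>S - {z}. x - w)" for z x
    by (simp add: L_def poly_prod)
  have degL: "degree (L z) < card S" if "z \<in> S" for z
  proof -
    have "degree (L z) \<le> (\<Sum>w\<in>S - {z}. degree [:- w, 1:])"
      unfolding L_def using degree_prod_sum_le[of "S - {z}" "\<lambda>w. [:- w, 1:]"] fin by (simp add: o_def)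
    also have "\<dots> = card S - 1" using that by simp
    also have "\<dots> < card S" using that fin card_gt_0_iff[of S] by auto
    finally show ?thesis .
  qed
  have "degree q < card S"
    unfolding q_def by (rule degree_sum_less) (use degL deg in \<open>auto intro: le_less_trans[OF degree_smult_le]\<close>)
  moreover have "poly p x = poly q x" if x: "x \<in> S" for x
  proof -
    have "poly (L z) x = 0" if "z \<in> S - {x}" for z
      unfolding L using that x fin by (intro prod_zero) auto
    then have "poly q x = poly p x / (\<Prod>w\<in>S - {x}. x - w) * poly (L x) x"
      using x fin by (simp add: q_def poly_sum sum.remove[OF fin x])
    also have "\<dots> = poly p x"
      unfolding L using fin by simp
    finally show ?thesis by simp
  qed
  ultimately have "p = q" using deg by (intro poly_eqI_degree[where A = S]) auto
  then have "poly p y = poly q y" by simp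
  also have "\<dots> = (\<Sum>z\<in>S. poly p z / (\<Prod>w\<in>S - {z}. z - w) * (\<Prod>w\<in>S - {z}. y - w))"
    by (simp add: q_def poly_sum L)
  finally have "poly p y / (\<Prod>z\<in>S. y - z) =
      (\<Sum>z\<in>S. poly p z / (\<Prod>w\<in>S - {z}. z - w) * (\<Prod>w\<in>S - {z}. y - w) / (\<Prod>z\<in>S. y - z))"
    by (simp add: sum_divide_distrib)
  also have "\<dots> = (\<Sum>z\<in>S. poly p z / (\<Prod>w\<in>S - {z}. z - w) / (y - z))"
  proof (rule sum.cong[OF refl])
    fix z assume z: "z \<in> S"
    have "(\<Prod>w\<in>S - {z}. y - w) \<noteq> 0" using y fin by auto
    then show "poly p z / (\<Prod>w\<in>S - {z}. z - w) * (\<Prod>w\<in>S - {z}. y - w) / (\<Prod>z\<in>S. y - z) =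
        poly p z / (\<Prod>w\<in>S - {z}. z - w) / (y - z)"
      unfolding prod.remove[OF fin z] by simp
  qed
  finally show ?thesis .
qed

text \<open>Expand prod (y + a_i) / ((y - v) prod (y + b_i)) in partial fractions in y, with simple
  poles at v and at the -b_j. After multiplication by prod (v + b_i) / prod (v + a_i), the pole at v
  contributes exactly 1 / (y - v).\<close>

lemma telescoping_step:
  fixes a b :: "'i \<Rightarrow> real"
  assumes fin: "finite I" and inj: "inj_on b I" and yv: "y \<noteq> v"
    and va: "\<And>i. i \<in> I \<Longrightarrow> v + a i \<noteq> 0" and vb: "\<And>i. i \<in> I \<Longrightarrow> v + b i \<noteq> 0"
    and yb: "\<And>i. i \<in> I \<Longrightarrow> y + b i \<noteq> 0"
  shows "1 / (y - v) - (\<Prod>i\<in>I. y + a i) * (\<Prod>i\<in>I. v + b i) / ((\<Prod>i\<in>I. y + b i) * (\<Prod>i\<in>I. v + a i)) / (y - v) =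
    (\<Sum>j\<in>I. (\<Prod>i\<in>I. a i - b j) * (\<Prod>i\<in>I - {j}. v + b i) /
      ((\<Prod>i\<in>I - {j}. b i - b j) * (\<Prod>i\<in>I. v + a i) * (y + b j)))"
proof -
  define B where "B = (\<lambda>i. - b i) ` I"
  define p where "p = (\<Prod>i\<in>I. [:a i, 1:])"
  have p: "poly p x = (\<Prod>i\<in>I. x + a i)" for x by (simp add: p_def poly_prod add.commute)
  have inj': "inj_on (\<lambda>i. - b i) J" if "J \<subseteq> I" for J
    using inj that by (auto simp: inj_on_def)
  have finB: "finite B" and vB: "v \<notin> B" and yB: "y \<notin> B"
    using fin vb yb by (force simp: B_def)+
  have card: "card (insert v B) = Suc (card I)"
    using finB vB card_image[OF inj', of I] by (simp add: B_def)
  have degp: "degree p < card (insert v B)"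
  proof -
    have "degree p \<le> (\<Sum>i\<in>I. degree [:a i, 1:])"
      unfolding p_def using degree_prod_sum_le[of I "\<lambda>i. [:a i, 1:]"] fin by (simp add: o_def)
    then show ?thesis by (simp add: card)
  qed
  have VA: "(\<Prod>i\<in>I. v + a i) \<noteq> 0" and VB: "(\<Prod>i\<in>I. v + b i) \<noteq> 0"
    using va vb fin by auto
  have "(\<Prod>i\<in>I. y + a i) / ((y - v) * (\<Prod>i\<in>I. y + b i)) = poly p y / (\<Prod>z\<in>insert v B. y - z)"
    using finB vB inj'[of I] by (simp add: p B_def prod.reindex)
  also have "\<dots> = (\<Sum>z\<in>insert v B. poly p z / (\<Prod>w\<in>insert v B - {z}. z - w) / (y - z))"
    by (rule partial_fractions) (use finB degp yv yB in auto)
  also have "\<dots> = poly p v / (\<Prod>w\<in>B. v - w) / (y - v) +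
      (\<Sum>z\<in>B. poly p z / (\<Prod>w\<in>insert v B - {z}. z - w) / (y - z))"
    using finB vB by simp
  also have "poly p v / (\<Prod>w\<in>B. v - w) / (y - v) = (\<Prod>i\<in>I. v + a i) / (\<Prod>i\<in>I. v + b i) / (y - v)"
    using inj'[of I] by (simp add: p B_def prod.reindex)
  also have "(\<Sum>z\<in>B. poly p z / (\<Prod>w\<in>insert v B - {z}. z - w) / (y - z)) =
      (\<Sum>j\<in>I. - (\<Prod>i\<in>I. a i - b j) / ((v + b j) * (\<Prod>i\<in>I - {j}. b i - b j)) / (y + b j))"
    unfolding B_def
  proof (subst sum.reindex[OF inj'[OF subset_refl]], rule sum.cong[OF refl], unfold o_def)
    fix j assume j: "j \<in> I"
    have "insert v ((\<lambda>i. - b i) ` I) - {- b j} = insert v ((\<lambda>i. - b i) ` (I - {j}))"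
      using j vb[OF j] inj by (auto simp: inj_on_def)
    moreover have "v \<notin> (\<lambda>i. - b i) ` (I - {j})" using vb by force
    ultimately have "(\<Prod>w\<in>insert v ((\<lambda>i. - b i) ` I) - {- b j}. - b j - w) =
        (- b j - v) * (\<Prod>i\<in>I - {j}. b i - b j)"
      using fin inj'[of "I - {j}"] by (simp add: prod.reindex)
    moreover have "poly p (- b j) = (\<Prod>i\<in>I. a i - b j)" by (simp add: p)
    moreover have "- b j - v = - (v + b j)" by simp
    ultimately show "poly p (- b j) / (\<Prod>w\<in>insert v ((\<lambda>i. - b i) ` I) - {- b j}. - b j - w) / (y - - b j) =
        - (\<Prod>i\<in>I. a i - b j) / ((v + b j) * (\<Prod>i\<in>I - {j}. b i - b j)) / (y + b j)"
      by (simp del: minus_add_distrib)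
  qed
  finally have *: "(\<Prod>i\<in>I. y + a i) / ((y - v) * (\<Prod>i\<in>I. y + b i)) =
      (\<Prod>i\<in>I. v + a i) / (\<Prod>i\<in>I. v + b i) / (y - v) +
      (\<Sum>j\<in>I. - (\<Prod>i\<in>I. a i - b j) / ((v + b j) * (\<Prod>i\<in>I - {j}. b i - b j)) / (y + b j))" .
  have "(\<Prod>i\<in>I. y + a i) * (\<Prod>i\<in>I. v + b i) / ((\<Prod>i\<in>I. y + b i) * (\<Prod>i\<in>I. v + a i)) / (y - v) =
      (\<Prod>i\<in>I. y + a i) / ((y - v) * (\<Prod>i\<in>I. y + b i)) * ((\<Prod>i\<in>I. v + b i) / (\<Prod>i\<in>I. v + a i))"
    by (simp add: field_simps)
  also have "\<dots> = (\<Prod>i\<in>I. v + a i) / (\<Prod>i\<in>I. v + b i) / (y - v) * ((\<Prod>i\<in>I. v + b i) / (\<Prod>i\<in>I. v + a i)) +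
      (\<Sum>j\<in>I. - (\<Prod>i\<in>I. a i - b j) / ((v + b j) * (\<Prod>i\<in>I - {j}. b i - b j)) / (y + b j) *
        ((\<Prod>i\<in>I. v + b i) / (\<Prod>i\<in>I. v + a i)))"
    unfolding * by (simp only: distrib_right sum_distrib_right)
  also have "(\<Prod>i\<in>I. v + a i) / (\<Prod>i\<in>I. v + b i) / (y - v) * ((\<Prod>i\<in>I. v + b i) / (\<Prod>i\<in>I. v + a i)) = 1 / (y - v)"
    using VA VB by simp
  also have "(\<Sum>j\<in>I. - (\<Prod>i\<in>I. a i - b j) / ((v + b j) * (\<Prod>i\<in>I - {j}. b i - b j)) / (y + b j) *
        ((\<Prod>i\<in>I. v + b i) / (\<Prod>i\<in>I. v + a i))) =
      - (\<Sum>j\<in>I. (\<Prod>i\<in>I. a i - b j) * (\<Prod>i\<in>I - {j}. v + b i) /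
      ((\<Prod>i\<in>I - {j}. b i - b j) * (\<Prod>i\<in>I. v + a i) * (y + b j)))"
    unfolding sum_negf[symmetric]
  proof (rule sum.cong[OF refl])
    fix j assume j: "j \<in> I"
    show "- (\<Prod>i\<in>I. a i - b j) / ((v + b j) * (\<Prod>i\<in>I - {j}. b i - b j)) / (y + b j) *
        ((\<Prod>i\<in>I. v + b i) / (\<Prod>i\<in>I. v + a i)) = - ((\<Prod>i\<in>I. a i - b j) * (\<Prod>i\<in>I - {j}. v + b i) /
      ((\<Prod>i\<in>I - {j}. b i - b j) * (\<Prod>i\<in>I. v + a i) * (y + b j)))"
      using vb[OF j] unfolding prod.remove[OF fin j, of "\<lambda>i. v + b i"] by (simp add: mult_ac)
  qed
  finally show ?thesis by simp
qed

text \<open>The factors with l < K give (-1)^K K!, those with l > K give (n - K - 1)!. This is the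
  source of the sign and the factorials in \<open>P_coeff\<close>.\<close>

lemma prod_of_nat_diff:
  assumes "K < n"
  shows "(\<Prod>l\<in>{..<n} - {K}. real l - real K) = (-1) ^ K * fact K * fact (n - K - 1)"
proof -
  have "Suc K \<le> n" using assms by simp
  then show ?thesis
  proof (induction n rule: nat_induct_at_least)
    case base
    have "{..<Suc K} - {K} = {0..<K}" by auto
    then show ?case using pochhammer_same[of K, where 'a = real]
      by (simp add: pochhammer_prod add.commute)
  next
    case (Suc n)
    have "{..<Suc n} - {K} = insert n ({..<n} - {K})" using Suc.hyps by auto
    moreover have "Suc n - K - 1 = Suc (n - K - 1)" using Suc.hyps by auto
    ultimately show ?case using Suc by (simp add: of_nat_diff)
  qed
qed

section \<open>Expansions in the functions phi_jk under nonresonance\<close>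

text \<open>
  Only these two conditions matter for the algebra: \<open>a_minus_b\<close> keeps the zeros of
  \<open>(s + a)\<^sub>k\<close> away from the pole \<open>- b\<^sub>j - k\<close>, and \<open>b_minus_b\<close> makes all poles simple.
\<close>

locale nonresonant =
  fixes r :: nat and a b :: "nat \<Rightarrow> real"
  assumes a_minus_b: "i \<in> {1..r} \<Longrightarrow> j \<in> {1..r} \<Longrightarrow> a i - b j \<noteq> real (Suc m)"
    and b_minus_b: "i \<in> {1..r} \<Longrightarrow> j \<in> {1..r} \<Longrightarrow> i \<noteq> j \<Longrightarrow> b i - b j \<notin> \<int>"
begin

text \<open>This is phi_jk of the overview: the Mellin transform of x^k w_j divided by Gamma(s + a)
  / Gamma(s + b).\<close>

definition mellin_ratio :: "nat \<Rightarrow> nat \<Rightarrow> real \<Rightarrow> real" where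
  "mellin_ratio j k s =
     (\<Prod>i=1..r. pochhammer (s + a i) k / pochhammer (s + b i) (k + of_bool (i = j)))"

lemma b_ne: "i \<in> {1..r} \<Longrightarrow> j \<in> {1..r} \<Longrightarrow> i \<noteq> j \<Longrightarrow> b i - b j + of_int m \<noteq> 0"
  using b_minus_b[of i j] by (metis Ints_minus Ints_of_int add_eq_0_iff2)

lemma inj_on_b: "inj_on b {1..r}"
  using b_ne[of _ _ 0] by (intro inj_onI) fastforce

lemma mellin_ratio_alt:
  assumes "j \<in> {1..r}"
  shows "mellin_ratio j k s = (\<Prod>i=1..r. pochhammer (s + a i) k) /
    ((\<Prod>i=1..r. pochhammer (s + b i) k) * (s + b j + real k))"
proof -
  have "(\<Prod>i=1..r. pochhammer (s + b i) (k + of_bool (i = j))) =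
      pochhammer (s + b j) (Suc k) * (\<Prod>i\<in>{1..r} - {j}. pochhammer (s + b i) k)"
    by (subst prod.remove[of "{1..r}" j]) (use assms in simp_all)
  also have "\<dots> = (\<Prod>i=1..r. pochhammer (s + b i) k) * (s + b j + real k)"
    unfolding prod.remove[OF finite_atLeastAtMost assms, of "\<lambda>i. pochhammer (s + b i) k"]
    by (simp add: pochhammer_Suc mult_ac)
  finally show ?thesis by (simp add: mellin_ratio_def prod_dividef)
qed

text \<open>The coefficient of phi_jk in the expansion of 1 / (s + b_J + K). The prefactor of the
  theorem is absorbed here, with (a - b_j)_1 inside \<open>cancelled_quotient\<close> so that a
  possible zero can cancel.\<close>

definition pole_coeff :: "nat \<Rightarrow> nat \<Rightarrow> nat \<Rightarrow> nat \<Rightarrow> real" where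
  "pole_coeff j J K k = vpoch ({1..r} - {j}) (\<lambda>i. b i - b J - real K) (k + 1) *
     pochhammer (b j - b J - real K) k * cancelled_quotient r a b j J K k /
     vpoch ({1..r} - {j}) (\<lambda>i. b i - b j) 1"

text \<open>
  With \<open>u = - b\<^sub>J - K\<close>, the products \<open>R k = (s + a)\<^sub>k (u + b)\<^sub>k / ((s + b)\<^sub>k (u + a)\<^sub>k)\<close> start at \<open>1\<close>.
  The sum telescopes over \<open>k < K\<close>, and \<open>R K / (s - u)\<close> is the single term \<open>j = J\<close>, \<open>k = K\<close>; stopping
  there avoids the possibly vanishing factor \<open>u + a\<^sub>i + K = a\<^sub>i - b\<^sub>J\<close> of \<open>(u + a)\<^sub>K\<^sub>+\<^sub>1\<close>.
\<close>

lemma inverse_expansion: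
  assumes J: "J \<in> {1..r}" and s: "\<And>i k. i \<in> {1..r} \<Longrightarrow> s + b i + real k \<noteq> 0"
  shows "1 / (s + b J + real K) =
    (\<Sum>j=1..r. \<Sum>k<K + of_bool (j = J). pole_coeff j J K k * mellin_ratio j k s)"
proof -
  define u where "u = - b J - real K"
  define SA where "SA k = (\<Prod>i=1..r. pochhammer (s + a i) k)" for k
  define SB where "SB k = (\<Prod>i=1..r. pochhammer (s + b i) k)" for k
  define UA where "UA k = (\<Prod>i=1..r. pochhammer (u + a i) k)" for k
  define UB where "UB k = (\<Prod>i=1..r. pochhammer (u + b i) k)" for k
  define R where "R k = SA k * UB k / (SB k * UA k)" for k
  note defs = SA_def SB_def UA_def UB_def
  have SA_Suc: "SA (Suc k) = SA k * (\<Prod>i=1..r. s + real k + a i)"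
    and SB_Suc: "SB (Suc k) = SB k * (\<Prod>i=1..r. s + real k + b i)"
    and UA_Suc: "UA (Suc k) = UA k * (\<Prod>i=1..r. u + real k + a i)"
    and UB_Suc: "UB (Suc k) = UB k * (\<Prod>i=1..r. u + real k + b i)" for k
    by (simp_all add: defs pochhammer_Suc prod.distrib add_ac)
  \<comment> \<open>The sum equals a_i - b_J - (K - k), and K - k is a positive integer.\<close>
  have ua: "u + real k + a i \<noteq> 0" if "k < K" "i \<in> {1..r}" for k i
    using a_minus_b[OF that(2) J, of "K - Suc k"] that by (auto simp: u_def of_nat_diff algebra_simps)
  \<comment> \<open>For i = J the sum is k - K, nonzero because k < K; for other i it is b_i - b_J
    plus an integer.\<close>
  have ub: "u + real k + b i \<noteq> 0" if "k < K" "i \<in> {1..r}" for k i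
    using b_ne[OF that(2) J, of "int k - int K"] that by (cases "i = J") (auto simp: u_def algebra_simps)
  have sb: "s + real k + b i \<noteq> 0" if "i \<in> {1..r}" for k i
    using s[OF that, of k] by (simp add: add_ac)
  have UA: "UA k \<noteq> 0" if "k \<le> K" for k
    using that
  proof (induction k)
    case (Suc k) then show ?case using ua[of k] by (simp add: UA_Suc)
  qed (simp add: UA_def)
  have bu: "b i - b J - real K = u + b i" for i by (simp add: u_def)
  have ubk: "pochhammer (u + b i) (k + 1) = pochhammer (u + b i) k * (u + real k + b i)" for i k
    by (simp add: pochhammer_Suc add_ac)
  have su: "s - u = s + b J + real K" "s - u \<noteq> 0"
    using s[OF J, of K] by (auto simp: u_def)
  have step: "R k / (s - u) - R (Suc k) / (s - u) = (\<Sum>j=1..r. pole_coeff j J K k * mellin_ratio j k s)"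
    if k: "k < K" for k
  proof -
    define QA where "QA = (\<Prod>i=1..r. u + real k + a i)"
    \<comment> \<open>\<open>telescoping_step\<close> is applied with y = s + k and v = u + k, so
      that y - v = s - u for every k.\<close>
    have "1 / (s + real k - (u + real k)) - (\<Prod>i=1..r. s + real k + a i) * (\<Prod>i=1..r. u + real k + b i) /
        ((\<Prod>i=1..r. s + real k + b i) * (\<Prod>i=1..r. u + real k + a i)) / (s + real k - (u + real k)) =
      (\<Sum>j=1..r. (\<Prod>i=1..r. a i - b j) * (\<Prod>i\<in>{1..r} - {j}. u + real k + b i) /
      ((\<Prod>i\<in>{1..r} - {j}. b i - b j) * (\<Prod>i=1..r. u + real k + a i) * (s + real k + b j)))"
      by (rule telescoping_step) (use inj_on_b ua[OF k] ub[OF k] sb su in auto)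
    moreover have "R k / (s - u) - R (Suc k) / (s - u) =
      R k * (1 / (s - u) - (\<Prod>i=1..r. s + real k + a i) * (\<Prod>i=1..r. u + real k + b i) /
        ((\<Prod>i=1..r. s + real k + b i) * QA) / (s - u))"
      by (simp add: R_def SA_Suc SB_Suc UA_Suc UB_Suc QA_def right_diff_distrib mult_ac)
    ultimately have "R k / (s - u) - R (Suc k) / (s - u) =
      R k * (\<Sum>j=1..r. (\<Prod>i=1..r. a i - b j) * (\<Prod>i\<in>{1..r} - {j}. u + real k + b i) /
      ((\<Prod>i\<in>{1..r} - {j}. b i - b j) * QA * (s + real k + b j)))"
      by (simp add: QA_def)
    also have "\<dots> = (\<Sum>j=1..r. pole_coeff j J K k * mellin_ratio j k s)"
      unfolding sum_distrib_left
    proof (rule sum.cong[OF refl])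
      fix j assume j: "j \<in> {1..r}"
      have "cancelled_quotient r a b j J K k =
          (\<Prod>i=1..r. a i - b j) / (\<Prod>i=1..r. pochhammer (u + a i) (Suc k))"
        using k by (simp add: cancelled_quotient_def prod_dividef u_def algebra_simps)
      also have "(\<Prod>i=1..r. pochhammer (u + a i) (Suc k)) = UA k * QA"
        using UA_Suc[of k] by (simp add: UA_def QA_def)
      finally have cq: "cancelled_quotient r a b j J K k = (\<Prod>i=1..r. a i - b j) / (UA k * QA)" .
      have "vpoch ({1..r} - {j}) (\<lambda>i. b i - b J - real K) (k + 1) * pochhammer (b j - b J - real K) k =
          UB k * (\<Prod>i\<in>{1..r} - {j}. u + real k + b i)"
        unfolding UB_def prod.remove[OF finite_atLeastAtMost j] vpoch_def
        by (simp only: bu ubk prod.distrib mult_ac)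
      then have "pole_coeff j J K k = UB k * (\<Prod>i\<in>{1..r} - {j}. u + real k + b i) *
          ((\<Prod>i=1..r. a i - b j) / (UA k * QA)) / (\<Prod>i\<in>{1..r} - {j}. b i - b j)"
        unfolding pole_coeff_def cq by (simp add: vpoch_def)
      moreover have "mellin_ratio j k s = SA k / (SB k * (s + real k + b j))"
        unfolding mellin_ratio_alt[OF j] by (simp add: SA_def SB_def add_ac)
      ultimately show "R k * ((\<Prod>i=1..r. a i - b j) * (\<Prod>i\<in>{1..r} - {j}. u + real k + b i) /
          ((\<Prod>i\<in>{1..r} - {j}. b i - b j) * QA * (s + real k + b j))) = pole_coeff j J K k * mellin_ratio j k s"
        by (simp add: R_def mult_ac)
    qed
    finally show ?thesis .
  qed
  \<comment> \<open>At k = K the additional factors are u + K + a_i = a_i - b_J and u + K + b_i =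
    b_i - b_J. The former cancel within \<open>cancelled_quotient\<close>, whose first branch covers
    a_i = b_J; the latter cancel against the denominator of \<open>pole_coeff\<close>.\<close>
  have last: "R K / (s - u) = pole_coeff J J K K * mellin_ratio J K s"
  proof -
    have "cancelled_quotient r a b J J K K = (\<Prod>i=1..r. 1 / pochhammer (u + a i) K)"
      unfolding cancelled_quotient_def
    proof (rule prod.cong[OF refl])
      fix i
      have au: "a i - b J - real K = u + a i" by (simp add: u_def)
      moreover have "pochhammer (a i - b J - real K) (K + 1) = pochhammer (u + a i) K * (a i - b J)"
        by (simp only: au Suc_eq_plus1[symmetric] pochhammer_Suc) (simp add: u_def)
      ultimately show "(if J = J \<and> K = K \<and> a i = b J then 1 / pochhammer (a i - b J - real K) K
          else pochhammer (a i - b J) 1 / pochhammer (a i - b J - real K) (K + 1)) = 1 / pochhammer (u + a i) K"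
        by (cases "a i = b J") (simp_all only: simp_thms if_True if_False, simp)
    qed
    then have cq: "cancelled_quotient r a b J J K K = 1 / UA K"
      by (simp add: UA_def prod_dividef)
    have "(\<Prod>i\<in>{1..r} - {J}. b i - b J) \<noteq> 0"
      using b_ne[OF _ J, of _ 0] by auto
    moreover have "vpoch ({1..r} - {J}) (\<lambda>i. b i - b J - real K) (K + 1) * pochhammer (b J - b J - real K) K =
          UB K * (\<Prod>i\<in>{1..r} - {J}. b i - b J)"
      unfolding UB_def prod.remove[OF finite_atLeastAtMost J] vpoch_def
      by (simp only: bu ubk prod.distrib mult_ac) (simp add: u_def mult_ac)
    ultimately have "pole_coeff J J K K = UB K / UA K"
      unfolding pole_coeff_def cq by (simp add: vpoch_def)
    then show ?thesis
      unfolding mellin_ratio_alt[OF J] by (simp add: R_def SA_def SB_def su mult_ac)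
  qed
  have "1 / (s + b J + real K) = R 0 / (s - u)"
    by (simp add: R_def defs su)
  also have "\<dots> = (\<Sum>k<K. R k / (s - u) - R (Suc k) / (s - u)) + R K / (s - u)"
    using sum_lessThan_telescope'[of "\<lambda>k. R k / (s - u)" K] by simp
  also have "\<dots> = (\<Sum>j=1..r. \<Sum>k<K. pole_coeff j J K k * mellin_ratio j k s) + pole_coeff J J K K * mellin_ratio J K s"
    unfolding last by (subst sum.swap) (simp add: step)
  also have "\<dots> = (\<Sum>j=1..r. \<Sum>k<K + of_bool (j = J). pole_coeff j J K k * mellin_ratio j k s)"
    unfolding sum.remove[OF finite_atLeastAtMost J] by simp
  finally show ?thesis .
qed

text \<open>The nodes -b_J - K are |n| distinct points, since b_J - b_J' is never an integer, and
  the numerator has degree at most |n| - 1. At the node of (J, K), the nodes of each i other than J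
  contribute a Pochhammer symbol and those of J itself the factorials.\<close>

lemma partial_fractions_P_coeff:
  assumes N: "msize r n \<ge> 1" and s: "\<And>i k. i \<in> {1..r} \<Longrightarrow> s + b i + real k \<noteq> 0"
  shows "pochhammer (1 - s) (msize r n - 1) / (\<Prod>i=1..r. pochhammer (s + b i) (n i)) =
    (\<Sum>J=1..r. \<Sum>K<n J. P_coeff r b n J K / (s + b J + real K))"
proof -
  define I where "I = Sigma {1..r} (\<lambda>J. {..<n J})"
  define x where "x = (\<lambda>(J, K). - b J - real K)"
  define p where "p = (\<Prod>i<msize r n - 1. [:1 + real i, -1:])"
  have p: "poly p z = pochhammer (1 - z) (msize r n - 1)" for z
    by (simp add: p_def poly_prod pochhammer_prod atLeast0LessThan algebra_simps)
  have fin: "finite I" by (simp add: I_def)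
  have x_inj: "inj_on x I"
  proof (rule inj_onI)
    fix u v assume uv: "u \<in> I" "v \<in> I" "x u = x v"
    obtain J K J' K' where [simp]: "u = (J, K)" "v = (J', K')" by (cases u, cases v) auto
    have "J = J'" using uv b_ne[of J J' "int K - int K'"] by (auto simp: I_def x_def)
    then show "u = v" using uv by (auto simp: x_def)
  qed
  have card: "card (x ` I) = msize r n"
    using card_image[OF x_inj] by (simp add: I_def msize_def)
  have "degree p \<le> (\<Sum>i<msize r n - 1. degree [:1 + real i, -1:])"
    unfolding p_def using degree_prod_sum_le[of "{..<msize r n - 1}" "\<lambda>i. [:1 + real i, -1:]"] by (simp add: o_def)
  then have deg: "degree p < card (x ` I)" using N by (simp add: card)
  have s': "s \<notin> x ` I" using s by (force simp: x_def I_def)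
  have prodI: "(\<Prod>u\<in>I. f u) = (\<Prod>J=1..r. \<Prod>K<n J. f (J, K))" for f :: "nat \<times> nat \<Rightarrow> real"
    unfolding I_def by (subst prod.Sigma) auto
  have "(\<Prod>z\<in>x ` I. s - z) = (\<Prod>i=1..r. pochhammer (s + b i) (n i))"
    unfolding prod.reindex[OF x_inj] prodI
    by (simp add: x_def pochhammer_prod atLeast0LessThan algebra_simps)
  then have "pochhammer (1 - s) (msize r n - 1) / (\<Prod>i=1..r. pochhammer (s + b i) (n i)) =
      poly p s / (\<Prod>z\<in>x ` I. s - z)" by (simp add: p)
  also have "\<dots> = (\<Sum>z\<in>x ` I. poly p z / (\<Prod>w\<in>x ` I - {z}. z - w) / (s - z))"
    by (rule partial_fractions) (use fin deg s' in auto)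
  also have "\<dots> = (\<Sum>u\<in>I. poly p (x u) / (\<Prod>w\<in>x ` I - {x u}. x u - w) / (s - x u))"
    by (simp add: sum.reindex[OF x_inj])
  also have "\<dots> = (\<Sum>(J, K)\<in>I. P_coeff r b n J K / (s + b J + real K))"
  proof (rule sum.cong[OF refl], clarify)
    fix J K assume JK: "(J, K) \<in> I"
    then have J: "J \<in> {1..r}" and K: "K < n J" by (auto simp: I_def)
    have "x ` I - {x (J, K)} = x ` (I - {(J, K)})"
      using x_inj JK by (simp add: inj_on_image_set_diff[of _ I])
    then have "(\<Prod>w\<in>x ` I - {x (J, K)}. x (J, K) - w) = (\<Prod>u\<in>I - {(J, K)}. x (J, K) - x u)"
      using prod.reindex[OF inj_on_subset[OF x_inj, of "I - {(J, K)}"]] by simp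
    also have "I - {(J, K)} = Sigma ({1..r} - {J}) (\<lambda>J. {..<n J}) \<union> {J} \<times> ({..<n J} - {K})"
      using J by (auto simp: I_def)
    also have "(\<Prod>u\<in>\<dots>. x (J, K) - x u) =
        (\<Prod>u\<in>Sigma ({1..r} - {J}) (\<lambda>J. {..<n J}). x (J, K) - x u) *
        (\<Prod>u\<in>{J} \<times> ({..<n J} - {K}). x (J, K) - x u)"
      by (subst prod.union_disjoint) auto
    also have "(\<Prod>u\<in>Sigma ({1..r} - {J}) (\<lambda>J. {..<n J}). x (J, K) - x u) =
        (\<Prod>i\<in>{1..r} - {J}. \<Prod>l<n i. x (J, K) - x (i, l))"
      by (subst prod.Sigma) auto
    also have "{J} \<times> ({..<n J} - {K}) = Pair J ` ({..<n J} - {K})" by auto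
    also have "(\<Prod>u\<in>\<dots>. x (J, K) - x u) = (\<Prod>l\<in>{..<n J} - {K}. x (J, K) - x (J, l))"
      by (simp add: prod.reindex inj_on_def)
    also have "(\<Prod>i\<in>{1..r} - {J}. \<Prod>l<n i. x (J, K) - x (i, l)) =
        (\<Prod>i\<in>{1..r} - {J}. pochhammer (b i - b J - real K) (n i))"
      by (simp add: x_def pochhammer_prod atLeast0LessThan algebra_simps)
    also have "(\<Prod>l\<in>{..<n J} - {K}. x (J, K) - x (J, l)) = (-1) ^ K * fact K * fact (n J - K - 1)"
      unfolding prod_of_nat_diff[OF K, symmetric] by (simp add: x_def)
    finally have "(\<Prod>w\<in>x ` I - {x (J, K)}. x (J, K) - w) =
        (\<Prod>i\<in>{1..r} - {J}. pochhammer (b i - b J - real K) (n i)) * ((-1) ^ K * fact K * fact (n J - K - 1))" .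
    moreover have "poly p (x (J, K)) = pochhammer (b J + real K + 1) (msize r n - 1)"
      by (simp add: p x_def algebra_simps)
    moreover have "s - x (J, K) = s + b J + real K" by (simp add: x_def)
    \<comment> \<open>(-1)^K is its own inverse, so it can move to the numerator as in
      \<open>P_coeff\<close>.\<close>
    moreover have "c / (q * ((-1) ^ K * f * g)) = c / q * ((-1) ^ K / (f * g))" for c q f g :: real
      by (cases "even K") auto
    ultimately show "poly p (x (J, K)) / (\<Prod>w\<in>x ` I - {x (J, K)}. x (J, K) - w) / (s - x (J, K)) =
        P_coeff r b n J K / (s + b J + real K)"
      unfolding P_coeff_def by (simp only:)
  qed
  also have "\<dots> = (\<Sum>J=1..r. \<Sum>K<n J. P_coeff r b n J K / (s + b J + real K))"
    unfolding I_def by (subst sum.Sigma) auto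
  finally show ?thesis .
qed

text \<open>
  Among the functions with index \<open>k' \<le> k\<close>, only that of \<open>(j, k)\<close> has a pole at \<open>- b\<^sub>j - k\<close>, so the
  coefficients vanish by descending induction on \<open>k\<close>. Multiplying by \<open>(s + b)\<^sub>M\<close> turns the poles into
  point evaluations of polynomials.
\<close>

lemma mellin_ratio_independent:
  assumes zero: "\<And>s. s > 1 \<Longrightarrow> (\<Sum>j=1..r. \<Sum>k<M. d j k * mellin_ratio j k s) = 0"
    and b: "\<And>i. i \<in> {1..r} \<Longrightarrow> b i > -1"
    and jk: "j \<in> {1..r}" "k < M"
  shows "d j k = 0"
proof -
  \<comment> \<open>For k < M this is phi_jk times prod (s + b_i)_M: the second product collects the
    factors of (s + b_i)_M that survive the denominator of phi_jk.\<close>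
  define \<Psi> where "\<Psi> j k = (\<Prod>i=1..r. (\<Prod>l<k. [:a i + real l, 1:]) *
    (\<Prod>l\<in>{k + of_bool (i = j)..<M}. [:b i + real l, 1:]))" for j k
  define q where "q = (\<Sum>j=1..r. \<Sum>k<M. smult (d j k) (\<Psi> j k))"
  have \<Psi>: "poly (\<Psi> j k) s = (\<Prod>i=1..r. (\<Prod>l<k. s + a i + real l) *
    (\<Prod>l\<in>{k + of_bool (i = j)..<M}. s + b i + real l))" for j k s
    by (simp add: \<Psi>_def poly_prod add_ac)
  have "poly q s = 0" if s: "s > 1" for s
  proof -
    have "poly (\<Psi> j k) s = mellin_ratio j k s * (\<Prod>i=1..r. pochhammer (s + b i) M)" if "k < M" for j k
      unfolding \<Psi> mellin_ratio_def prod.distrib[symmetric]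
    proof (rule prod.cong[OF refl])
      fix i assume i: "i \<in> {1..r}"
      have "pochhammer (s + b i) (k + of_bool (i = j)) > 0"
        using b[OF i] s by (intro pochhammer_pos) auto
      moreover have "pochhammer (s + b i) M = pochhammer (s + b i) (k + of_bool (i = j)) *
          (\<Prod>l\<in>{k + of_bool (i = j)..<M}. s + b i + real l)"
        unfolding pochhammer_prod using that by (intro prod.atLeastLessThan_concat[symmetric]) auto
      ultimately show "(\<Prod>l<k. s + a i + real l) * (\<Prod>l\<in>{k + of_bool (i = j)..<M}. s + b i + real l) =
          pochhammer (s + a i) k / pochhammer (s + b i) (k + of_bool (i = j)) * pochhammer (s + b i) M"
        by (simp add: pochhammer_prod[of "s + a i"] atLeast0LessThan)
    qed
    then have "poly q s = (\<Sum>j=1..r. \<Sum>k<M. d j k * mellin_ratio j k s) * (\<Prod>i=1..r. pochhammer (s + b i) M)"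
      by (simp add: q_def poly_sum sum_distrib_right mult.assoc)
    then show ?thesis using zero[OF s] by simp
  qed
  then have "{1<..} \<subseteq> {s. poly q s = 0}" by auto
  then have "q = 0" using poly_roots_finite[of q] infinite_Ioi[of "1::real"] finite_subset by blast
  \<comment> \<open>The factor with i = j and l = k in the second product of the polynomial for (j',
    k') is zero at -b_j - k; the bound on k' ensures that it occurs.\<close>
  have vanish: "poly (\<Psi> j' k') (- b j - real k) = 0"
    if "j \<in> {1..r}" "k < M" "k' + of_bool (j = j') \<le> k" for j k j' k'
    unfolding \<Psi> using that by (intro prod_zero[OF _ bexI[of _ j]]) (auto intro!: bexI[of _ k])
  \<comment> \<open>For (j, k) itself that factor is missing, and nonresonance keeps all the others
    away from zero.\<close>
  have nonvanish: "poly (\<Psi> j k) (- b j - real k) \<noteq> 0" if "j \<in> {1..r}" "k < M" for j k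
  proof -
    have "- b j - real k + a i + real l \<noteq> 0" if "i \<in> {1..r}" "l < k" for i l
      using a_minus_b[OF that(1) \<open>j \<in> {1..r}\<close>, of "k - Suc l"] that by (auto simp: of_nat_diff)
    moreover have "- b j - real k + b i + real l \<noteq> 0"
      if "i \<in> {1..r}" "l \<ge> k + of_bool (i = j)" for i l
      using b_ne[OF that(1) \<open>j \<in> {1..r}\<close>, of "int l - int k"] that by (cases "i = j") (auto simp: algebra_simps)
    ultimately show ?thesis unfolding \<Psi> by simp
  qed
  have "\<forall>j\<in>{1..r}. d j k = 0" if "k < M" for k
    using that
  proof (induction "M - k" arbitrary: k rule: less_induct)
    case less
    have IH: "d j' k' = 0" if "j' \<in> {1..r}" "k < k'" "k' < M" for j' k'
      using less.hyps[of k'] that by auto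
    show ?case
    proof
      fix j assume j: "j \<in> {1..r}"
      have other: "d j' k' * poly (\<Psi> j' k') (- b j - real k) = 0"
        if "j' \<in> {1..r}" "k' < M" "(j', k') \<noteq> (j, k)" for j' k'
      proof (cases "k < k'")
        case True then show ?thesis using IH that by simp
      next
        case False
        \<comment> \<open>If j' = j then k' < k because the pairs differ; otherwise k' <= k is
          enough.\<close>
        then have "k' + of_bool (j = j') \<le> k" using that by auto
        then show ?thesis using vanish[OF j less.prems] by simp
      qed
      have "0 = poly q (- b j - real k)" using \<open>q = 0\<close> by simp
      also have "\<dots> = (\<Sum>j'=1..r. \<Sum>k'<M. d j' k' * poly (\<Psi> j' k') (- b j - real k))"
        by (simp add: q_def poly_sum)
      also have "\<dots> = (\<Sum>(j', k')\<in>{1..r} \<times> {..<M}. d j' k' * poly (\<Psi> j' k') (- b j - real k))"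
        by (simp add: sum.cartesian_product)
      also have "\<dots> = (\<Sum>(j', k')\<in>{(j, k)}. d j' k' * poly (\<Psi> j' k') (- b j - real k))"
      proof (rule sum.mono_neutral_right)
        show "\<forall>u\<in>{1..r} \<times> {..<M} - {(j, k)}. (case u of (j', k') \<Rightarrow> d j' k' * poly (\<Psi> j' k') (- b j - real k)) = 0"
        proof
          fix u assume u: "u \<in> {1..r} \<times> {..<M} - {(j, k)}"
          obtain j' k' where [simp]: "u = (j', k')" by (cases u)
          show "(case u of (j', k') \<Rightarrow> d j' k' * poly (\<Psi> j' k') (- b j - real k)) = 0"
            unfolding \<open>u = _\<close> prod.case by (rule other) (use u in auto)
        qed
      qed (use j less.prems in auto)
      finally show "d j k = 0" using nonvanish[OF j less.prems] by simp
    qed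
  qed
  then show ?thesis using jk by blast
qed

subsection \<open>The linear form\<close>

text \<open>Divide the normalization by \<open>G\<close>. For s > 1 all s + a_i and s + b_i are
  positive, so \<open>G\<close> is nonzero and the functional equation of Gamma turns the remaining
  quotients into Pochhammer symbols.\<close>

lemma normalized_linear_form:
  fixes A :: "nat \<Rightarrow> real poly"
  assumes r: "r \<ge> 1"
    and a: "\<And>i. i \<in> {1..r} \<Longrightarrow> a i > -1" and ab: "\<And>i. i \<in> {1..r} \<Longrightarrow> a i < b i"
    and norm: "normalized r a b n (linear_form r (weight r a b) A)" and s: "s > 1"
  shows "(\<Sum>j=1..r. \<Sum>k\<le>degree (A j). coeff (A j) k * mellin_ratio j k s) =
    pochhammer (1 - s) (msize r n - 1) / (\<Prod>i=1..r. pochhammer (s + b i) (n i))" (is "?L = ?R")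
proof -
  define G where "G = (\<Prod>i=1..r. Gamma (s + a i)) / (\<Prod>i=1..r. Gamma (s + b i))"
  have pos: "s + a i > 0" "s + b i > 0" if "i \<in> {1..r}" for i
    using a[OF that] ab[OF that] s by auto
  then have G: "G \<noteq> 0"
    by (auto simp: G_def intro!: less_imp_neq[OF Gamma_real_pos, symmetric])
  have shift: "Gamma (y + real m) = pochhammer y m * Gamma y" if "y > 0" for y m
  proof -
    have "y \<notin> \<int>\<^sub>\<le>\<^sub>0" using that by (auto elim!: nonpos_Ints_cases)
    moreover have "Gamma y \<noteq> 0" using Gamma_real_pos[OF that] by simp
    ultimately show ?thesis by (simp add: pochhammer_Gamma)
  qed
  have ratio: "(\<Prod>i=1..r. Gamma (s + real k + a i) / Gamma (s + real k + b i + of_bool (i = j))) =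
      G * mellin_ratio j k s" for j k
    unfolding G_def mellin_ratio_def prod_dividef[symmetric] prod.distrib[symmetric]
  proof (rule prod.cong[OF refl])
    fix i assume i: "i \<in> {1..r}"
    have "s + real k + a i = s + a i + real k"
      "s + real k + b i + of_bool (i = j) = s + b i + real (k + of_bool (i = j))" by auto
    then show "Gamma (s + real k + a i) / Gamma (s + real k + b i + of_bool (i = j)) =
        Gamma (s + a i) / Gamma (s + b i) * (pochhammer (s + a i) k / pochhammer (s + b i) (k + of_bool (i = j)))"
      using pos[OF i] by (simp only: shift times_divide_times_eq mult.commute)
  qed
  have "complex_of_real (\<Sum>j=1..r. \<Sum>k\<le>degree (A j). coeff (A j) k * (G * mellin_ratio j k s)) =
      mellin_01 (linear_form r (weight r a b) A) (of_real s)"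
    using mellin_01_linear_form[OF r ab pos(1), where A = A] by (simp only: ratio)
  also have "\<dots> = vGamma {1..r} (\<lambda>i. of_real s + of_real (a i)) /
      vGamma {1..r} (\<lambda>i. of_real s + of_real (b i) + of_nat (n i)) * pochhammer (1 - of_real s) (msize r n - 1)"
  proof -
    have "Re (of_real s) > - a i" if "i \<in> {1..r}" for i using pos(1)[OF that] by simp
    then show ?thesis using norm unfolding normalized_def by blast
  qed
  also have "\<dots> = complex_of_real ((\<Prod>i=1..r. Gamma (s + a i)) / (\<Prod>i=1..r. Gamma (s + b i + real (n i))) *
      pochhammer (1 - s) (msize r n - 1))"
    by (simp add: vGamma_def pochhammer_prod flip: Gamma_complex_of_real)
  also have "(\<Prod>i=1..r. Gamma (s + b i + real (n i))) =
      (\<Prod>i=1..r. pochhammer (s + b i) (n i)) * (\<Prod>i=1..r. Gamma (s + b i))"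
    unfolding prod.distrib[symmetric] by (rule prod.cong[OF refl]) (use pos shift in auto)
  finally have "(\<Sum>j=1..r. \<Sum>k\<le>degree (A j). coeff (A j) k * (G * mellin_ratio j k s)) = G * ?R"
    unfolding of_real_eq_iff by (simp add: G_def mult_ac)
  moreover have "(\<Sum>j=1..r. \<Sum>k\<le>degree (A j). coeff (A j) k * (G * mellin_ratio j k s)) = G * ?L"
    by (simp add: sum_distrib_left mult_ac)
  ultimately have "G * ?L = G * ?R" by (simp only:)
  then show ?thesis using G by (simp only: mult_cancel_left simp_thms)
qed

text \<open>The coefficients of the A_j and the explicit numbers \<open>c\<close> expand the same
  function of s > 1 in the phi_jk, so independence identifies them.\<close>

lemma normalized_linear_form_poly:
  fixes A :: "nat \<Rightarrow> real poly"
  assumes r: "r \<ge> 1"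
    and a: "\<And>i. i \<in> {1..r} \<Longrightarrow> a i > -1" and ab: "\<And>i. i \<in> {1..r} \<Longrightarrow> a i < b i"
    and N: "msize r n \<ge> 1"
    and norm: "normalized r a b n (linear_form r (weight r a b) A)"
    and j: "j \<in> {1..r}"
  shows "poly (A j) x = (\<Sum>J=1..r. \<Sum>K<n J. P_coeff r b n J K *
    (\<Sum>k<K + of_bool (j = J). pole_coeff j J K k * x ^ k))"
proof -
  \<comment> \<open>\<open>M\<close> exceeds all degrees and all n_i, so both coefficient families
    can be padded with zeros to the common range k < M.\<close>
  define M where "M = Suc (\<Sum>i=1..r. degree (A i) + n i)"
  have "degree (A i) + n i < M" if "i \<in> {1..r}" for i
    using member_le_sum[of i "{1..r}" "\<lambda>i. degree (A i) + n i"] that by (simp add: M_def)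
  then have M: "degree (A i) < M" "n i < M" if "i \<in> {1..r}" for i
    using that by fastforce+
  define c where "c j k = (\<Sum>J=1..r. \<Sum>K<n J. P_coeff r b n J K *
    (if k < K + of_bool (j = J) then pole_coeff j J K k else 0))" for j k
  have extend_A: "(\<Sum>k\<le>degree (A j). coeff (A j) k * f k) = (\<Sum>k<M. coeff (A j) k * f k)"
    if "j \<in> {1..r}" for j and f :: "nat \<Rightarrow> real"
    by (rule sum.mono_neutral_left) (use M(1)[OF that] in \<open>auto simp: coeff_eq_0\<close>)
  have extend: "(\<Sum>k<K + of_bool (j = J). pole_coeff j J K k * f k) =
      (\<Sum>k<M. (if k < K + of_bool (j = J) then pole_coeff j J K k else 0) * f k)"
    if "J \<in> {1..r}" "K < n J" for j J K and f :: "nat \<Rightarrow> real"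
    using M(2)[OF that(1)] that(2) by (intro sum.mono_neutral_cong_left) auto
  \<comment> \<open>The function \<open>f\<close> is left arbitrary because two instances are
    needed: \<open>mellin_ratio j k s\<close> to compare transforms, and \<open>x ^ k\<close> to
    recover the polynomial.\<close>
  have collect: "(\<Sum>J=1..r. \<Sum>K<n J. P_coeff r b n J K *
      (\<Sum>k<K + of_bool (j = J). pole_coeff j J K k * f k)) = (\<Sum>k<M. c j k * f k)" for j and f :: "nat \<Rightarrow> real"
  proof -
    have "(\<Sum>J=1..r. \<Sum>K<n J. P_coeff r b n J K *
        (\<Sum>k<K + of_bool (j = J). pole_coeff j J K k * f k)) =
      (\<Sum>J=1..r. \<Sum>K<n J. \<Sum>k<M. P_coeff r b n J K *
        (if k < K + of_bool (j = J) then pole_coeff j J K k else 0) * f k)"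
      by (intro sum.cong refl) (simp only: extend lessThan_iff sum_distrib_left mult.assoc)
    also have "\<dots> = (\<Sum>J=1..r. \<Sum>k<M. \<Sum>K<n J. P_coeff r b n J K *
        (if k < K + of_bool (j = J) then pole_coeff j J K k else 0) * f k)"
      by (intro sum.cong refl sum.swap)
    also have "\<dots> = (\<Sum>k<M. c j k * f k)"
      unfolding c_def sum_distrib_right by (rule sum.swap)
    finally show ?thesis .
  qed
  have "(\<Sum>j=1..r. \<Sum>k<M. (coeff (A j) k - c j k) * mellin_ratio j k s) = 0" if s: "s > 1" for s
  proof -
    have sb: "s + b i + real k \<noteq> 0" if "i \<in> {1..r}" for i k
      using a[OF that] ab[OF that] s by (auto simp: add_pos_nonneg less_imp_neq[symmetric])
    have "(\<Sum>j=1..r. \<Sum>k<M. coeff (A j) k * mellin_ratio j k s) =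
        (\<Sum>J=1..r. \<Sum>K<n J. P_coeff r b n J K / (s + b J + real K))"
      using normalized_linear_form[OF r a ab norm s] partial_fractions_P_coeff[OF N sb]
      by (simp add: extend_A)
    also have "\<dots> = (\<Sum>J=1..r. \<Sum>K<n J. \<Sum>j=1..r. P_coeff r b n J K *
        (\<Sum>k<K + of_bool (j = J). pole_coeff j J K k * mellin_ratio j k s))"
    proof (intro sum.cong refl)
      fix J K assume "J \<in> {1..r}"
      from inverse_expansion[OF this sb, of K]
      have "P_coeff r b n J K * (1 / (s + b J + real K)) = P_coeff r b n J K *
          (\<Sum>j=1..r. \<Sum>k<K + of_bool (j = J). pole_coeff j J K k * mellin_ratio j k s)"
        by (simp only:)
      then show "P_coeff r b n J K / (s + b J + real K) = (\<Sum>j=1..r. P_coeff r b n J K *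
          (\<Sum>k<K + of_bool (j = J). pole_coeff j J K k * mellin_ratio j k s))"
        by (simp add: sum_distrib_left)
    qed
    also have "\<dots> = (\<Sum>J=1..r. \<Sum>j=1..r. \<Sum>K<n J. P_coeff r b n J K *
        (\<Sum>k<K + of_bool (j = J). pole_coeff j J K k * mellin_ratio j k s))"
      by (intro sum.cong refl sum.swap)
    also have "\<dots> = (\<Sum>j=1..r. \<Sum>k<M. c j k * mellin_ratio j k s)"
      unfolding collect[symmetric] by (rule sum.swap)
    finally show ?thesis by (simp add: left_diff_distrib sum_subtractf)
  qed
  moreover have "b i > -1" if "i \<in> {1..r}" for i using a[OF that] ab[OF that] by simp
  ultimately have c: "coeff (A j) k = c j k" if "k < M" for k
    using mellin_ratio_independent[where M = M and d = "\<lambda>j k. coeff (A j) k - c j k" and j = j and k = k] j that by simp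
  have "poly (A j) x = (\<Sum>k<M. coeff (A j) k * x ^ k)"
    unfolding poly_altdef by (rule extend_A[OF j])
  also have "\<dots> = (\<Sum>k<M. c j k * x ^ k)" by (simp add: c)
  finally show ?thesis unfolding collect .
qed

end

section \<open>Reduction of the theorem to nonresonance\<close>

theorem theorem2p12:
  fixes r :: nat and a b :: "nat \<Rightarrow> real" and n :: "nat \<Rightarrow> nat" and A :: "nat \<Rightarrow> real poly"
  assumes "r \<ge> 1"
    and "\<And>i. i \<in> {1..r} \<Longrightarrow> a i > -1"
    and "\<And>i. i \<in> {1..r} \<Longrightarrow> b i > -1"
    and "\<And>i. i \<in> {1..r} \<Longrightarrow> a i < b i"
    and "near_diagonal r n"
    and "msize r n \<ge> 1"
    and "\<And>i j. i \<in> {1..r} \<Longrightarrow> j \<in> {1..r} \<Longrightarrow> i \<noteq> j \<Longrightarrow> b j - a i \<notin> {x \<in> \<int>. x < 0}"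
    and "\<And>i j. i \<in> {1..r} \<Longrightarrow> j \<in> {1..r} \<Longrightarrow> i \<noteq> j \<Longrightarrow> b i - b j \<notin> \<nat>"
    and "type_I r (weight r a b) n A"
    and "normalized r a b n (linear_form r (weight r a b) A)"
  shows "\<forall>j\<in>{1..r}. \<forall>x::real.
    poly (A j) x =
      1 / vpoch ({1..r} - {j}) (\<lambda>i. b i - b j) 1 *
      (\<Sum>J=1..r. \<Sum>K<n J. P_coeff r b n J K *
        (\<Sum>k<K + of_bool (j = J).
           vpoch ({1..r} - {j}) (\<lambda>i. b i - b J - real K) (k + 1) *
           pochhammer (b j - b J - real K) k *
           cancelled_quotient r a b j J K k * x ^ k))"
proof (intro ballI allI)
  fix j x assume j: "j \<in> {1..r}"
  \<comment> \<open>The hypothesis on b_j - a_i covers distinct indices; for i = j the inequality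
    a_i < b_i excludes a positive difference.\<close>
  have a_minus_b: "a i - b j \<noteq> real (Suc m)" if ij: "i \<in> {1..r}" "j \<in> {1..r}" for i j m
  proof
    assume eq: "a i - b j = real (Suc m)"
    then have "i \<noteq> j" using assms(4)[OF ij(1)] by auto
    moreover have "b j - a i = - real (Suc m)" using eq by simp
    then have "b j - a i \<in> {x \<in> \<int>. x < 0}" by simp
    ultimately show False using assms(7)[OF ij] by blast
  qed
  \<comment> \<open>The hypothesis for (i, j) excludes nonnegative integers, and for (j, i)
    nonpositive ones.\<close>
  have b_minus_b: "b i - b j \<notin> \<int>" if "i \<in> {1..r}" "j \<in> {1..r}" "i \<noteq> j" for i j
  proof
    assume "b i - b j \<in> \<int>"
    then obtain m :: int where m: "b i - b j = of_int m" by (auto elim: Ints_cases)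
    then have "b i - b j = of_nat (nat m)" if "m \<ge> 0" using that by simp
    moreover have "b j - b i = of_nat (nat (- m))" if "m < 0" using that m by simp
    ultimately have "b i - b j \<in> \<nat> \<or> b j - b i \<in> \<nat>"
      by (metis not_le of_nat_in_Nats)
    then show False using assms(8) that by metis
  qed
  interpret nonresonant r a b
    by unfold_locales (fact a_minus_b b_minus_b)+
  have "poly (A j) x = (\<Sum>J=1..r. \<Sum>K<n J. P_coeff r b n J K *
      (\<Sum>k<K + of_bool (j = J). pole_coeff j J K k * x ^ k))"
    by (rule normalized_linear_form_poly) (fact assms j)+
  then show "poly (A j) x =
      1 / vpoch ({1..r} - {j}) (\<lambda>i. b i - b j) 1 *
      (\<Sum>J=1..r. \<Sum>K<n J. P_coeff r b n J K *
        (\<Sum>k<K + of_bool (j = J).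
           vpoch ({1..r} - {j}) (\<lambda>i. b i - b J - real K) (k + 1) *
           pochhammer (b j - b J - real K) k *
           cancelled_quotient r a b j J K k * x ^ k))"
    by (simp add: pole_coeff_def sum_distrib_left mult_ac)
qed

end
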